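(* The random function $\Lambda_{\mathbf e}$ does not almost surely have a (two-sided) derivative at $0$; that is, it is not the case that $\Lambda_{\mathbf e}$ is differentiable at $0$ with probability $1$.
   Context: $\mathbf e:[0,1]\to[0,\infty)$ is a standard Brownian excursion (Brownian motion suitably conditioned on $\mathbf e(0)=\mathbf e(1)=0$ and $\mathbf e>0$ on $(0,1)$). $\Lambda_{\mathbf e}$ is the (a.s. existing) continuous random function on $[0,\infty)$ such that for every bounded measurable $f:[0,\infty)\to\mathbb R$, $\int_0^\infty f(x)\Lambda_{\mathbf e}(x)\,dx=2\iint_{0<s<t<1}f\bigl(\mathbf e(s)+\mathbf e(t)-2\min_{u\in[s,t]}\mathbf e(u)\bigr)\,ds\,dt$. It is regarded as a function on $\mathbb R$ by setting $\Lambda_{\mathbf e}(x)=0$ for $x<0$. *)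

theory Defs
  imports "HOL-Probability.Probability"
begin

section \<open>The standard Brownian excursion\<close>

text \<open>
  Transition density of Brownian motion killed on hitting \<open>0\<close>, for \<open>x, y > 0\<close>
  (by the reflection principle).
\<close>
definition killed_density :: "real \<Rightarrow> real \<Rightarrow> real \<Rightarrow> real" where
  "killed_density t x y = normal_density x (sqrt t) y - normal_density (- x) (sqrt t) y"

text \<open>Density at \<open>t\<close> of the first hitting time of \<open>0\<close> by Brownian motion started at \<open>x > 0\<close>.\<close>
definition hitting_density :: "real \<Rightarrow> real \<Rightarrow> real" where
  "hitting_density t x = x / t * normal_density 0 (sqrt t) x"

text \<open>
  Joint density at \<open>x\<^sub>0, \<dots>, x\<^sub>n > 0\<close> of the positions at times
  \<open>0 < t\<^sub>0 < \<dots> < t\<^sub>n < 1\<close> of Brownian motion started at \<open>a > 0\<close> and conditioned to stay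
  positive on \<open>[0,1]\<close> and to be at \<open>b > 0\<close> at time \<open>1\<close>.
\<close>
definition conditioned_density ::
    "real \<Rightarrow> real \<Rightarrow> nat \<Rightarrow> (nat \<Rightarrow> real) \<Rightarrow> (nat \<Rightarrow> real) \<Rightarrow> real" where
  "conditioned_density a b n t x =
     killed_density (t 0) a (x 0)
     * (\<Prod>i<n. killed_density (t (Suc i) - t i) (x i) (x (Suc i)))
     * killed_density (1 - t n) (x n) b / killed_density 1 a b"

text \<open>
  The usual finite-dimensional densities of the standard Brownian excursion. They are the limits
  of \<open>conditioned_density\<close> as \<open>a\<close> and \<open>b\<close> tend to \<open>0\<close>; see
  \<open>conditioned_density_tendsto\<close> below.
\<close>
definition excursion_density :: "nat \<Rightarrow> (nat \<Rightarrow> real) \<Rightarrow> (nat \<Rightarrow> real) \<Rightarrow> real" where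
  "excursion_density n t x =
     (if \<forall>i\<le>n. 0 < x i
      then 2 * sqrt (2 * pi) * hitting_density (t 0) (x 0)
           * (\<Prod>i<n. killed_density (t (Suc i) - t i) (x i) (x (Suc i)))
           * hitting_density (1 - t n) (x n)
      else 0)"

lemma killed_density_sym: "killed_density t x y = killed_density t y x"
  by (simp add: killed_density_def normal_density_def power2_commute add.commute)

lemma killed_density_sinh:
  assumes "0 < t"
  shows "killed_density t a x =
    normal_density 0 (sqrt t) x * exp (- a\<^sup>2 / (2 * t)) * (2 * sinh (a * x / t))"
proof -
  have A: "exp (- (x - a)\<^sup>2 / (2 * t)) = exp (- x\<^sup>2 / (2 * t)) * exp (- a\<^sup>2 / (2 * t)) * exp (a * x / t)"
    using assms by (simp flip: exp_add) (simp add: field_simps power2_eq_square)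
  have B: "exp (- (x + a)\<^sup>2 / (2 * t)) = exp (- x\<^sup>2 / (2 * t)) * exp (- a\<^sup>2 / (2 * t)) * exp (- (a * x / t))"
    using assms by (simp flip: exp_add) (simp add: field_simps power2_eq_square)
  show ?thesis
    using assms A B
    by (simp add: killed_density_def normal_density_def sinh_def algebra_simps diff_divide_distrib)
qed

lemma sinh_over_self: "((\<lambda>z::real. sinh z / z) \<longlongrightarrow> 1) (at 0)"
proof -
  have "(sinh has_field_derivative cosh (0::real)) (at 0)"
    by (auto intro!: derivative_eq_intros)
  then show ?thesis
    by (simp add: has_field_derivative_iff)
qed

lemma killed_density_over_self:
  assumes "0 < t" "0 < x"
  shows "((\<lambda>a. killed_density t a x / a) \<longlongrightarrow> 2 * hitting_density t x) (at_right 0)"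
proof -
  have lim: "filterlim (\<lambda>a. a * x / t) (at 0) (at_right 0)"
    using assms by (auto simp: filterlim_at eventually_at_filter intro!: tendsto_eq_intros)
  have "((\<lambda>a. normal_density 0 (sqrt t) x * exp (- a\<^sup>2 / (2 * t))
          * (2 * (sinh (a * x / t) / (a * x / t)) * (x / t)))
        \<longlongrightarrow> normal_density 0 (sqrt t) x * exp (- 0\<^sup>2 / (2 * t)) * (2 * 1 * (x / t))) (at_right 0)"
    using assms by (intro tendsto_intros filterlim_compose[OF sinh_over_self lim]) auto
  moreover have "\<forall>\<^sub>F a in at_right 0.
      normal_density 0 (sqrt t) x * exp (- a\<^sup>2 / (2 * t))
        * (2 * (sinh (a * x / t) / (a * x / t)) * (x / t)) = killed_density t a x / a"
    using assms
    by (auto simp: eventually_at_filter killed_density_sinh field_simps)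
  ultimately have "((\<lambda>a. killed_density t a x / a)
      \<longlongrightarrow> normal_density 0 (sqrt t) x * exp (- 0\<^sup>2 / (2 * t)) * (2 * 1 * (x / t))) (at_right 0)"
    by (rule Lim_transform_eventually)
  then show ?thesis
    by (simp add: hitting_density_def mult_ac)
qed

lemma killed_density_over_both:
  "((\<lambda>(a, b). killed_density 1 a b / (a * b)) \<longlongrightarrow> 2 / sqrt (2 * pi))
     (at_right 0 \<times>\<^sub>F at_right 0)"
proof -
  let ?F = "at_right (0::real) \<times>\<^sub>F at_right (0::real)"
  have fs: "filterlim fst (at_right 0) ?F" "filterlim snd (at_right 0) ?F"
    by (rule filterlim_fst filterlim_snd)+
  have t0: "(fst \<longlongrightarrow> 0) ?F" "(snd \<longlongrightarrow> 0) ?F"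
    using fs by (auto simp: filterlim_at)
  have pos: "\<forall>\<^sub>F p in ?F. 0 < fst p \<and> 0 < snd p"
    using fs by (auto simp: filterlim_at eventually_conj_iff)
  have "((\<lambda>p. fst p * snd p) \<longlongrightarrow> 0) ?F"
    using tendsto_mult[OF t0] by simp
  then have lim: "filterlim (\<lambda>p. fst p * snd p) (at 0) ?F"
    using pos by (auto simp: filterlim_at elim: eventually_mono)
  have "((\<lambda>p. 1 / sqrt (2 * pi) * exp (- (snd p)\<^sup>2 / 2) * exp (- (fst p)\<^sup>2 / 2)
           * (2 * (sinh (fst p * snd p) / (fst p * snd p))))
         \<longlongrightarrow> 1 / sqrt (2 * pi) * exp (- 0\<^sup>2 / 2) * exp (- 0\<^sup>2 / 2) * (2 * 1)) ?F"
    by (intro tendsto_intros t0 filterlim_compose[OF sinh_over_self lim]) auto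
  then show ?thesis
    by (simp add: killed_density_sinh normal_density_def case_prod_beta')
qed

lemma conditioned_density_tendsto:
  assumes t: "0 < t 0" "t n < 1" and x: "\<And>i. i \<le> n \<Longrightarrow> 0 < x i"
  shows "((\<lambda>(a, b). conditioned_density a b n t x) \<longlongrightarrow> excursion_density n t x)
     (at_right 0 \<times>\<^sub>F at_right 0)"
proof -
  let ?F = "at_right (0::real) \<times>\<^sub>F at_right (0::real)"
  let ?P = "\<Prod>i<n. killed_density (t (Suc i) - t i) (x i) (x (Suc i))"
  have fs: "filterlim fst (at_right 0) ?F" "filterlim snd (at_right 0) ?F"
    by (rule filterlim_fst filterlim_snd)+
  have pos: "\<forall>\<^sub>F p in ?F. 0 < fst p \<and> 0 < snd p"
    using fs by (auto simp: filterlim_at eventually_conj_iff)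
  have 1: "((\<lambda>p. killed_density (t 0) (fst p) (x 0) / fst p)
              \<longlongrightarrow> 2 * hitting_density (t 0) (x 0)) ?F"
    using t x by (intro filterlim_compose[OF killed_density_over_self fs(1)]) auto
  have 2: "((\<lambda>p. killed_density (1 - t n) (x n) (snd p) / snd p)
              \<longlongrightarrow> 2 * hitting_density (1 - t n) (x n)) ?F"
    using t x unfolding killed_density_sym[of _ "x n"]
    by (intro filterlim_compose[OF killed_density_over_self fs(2)]) auto
  have 3: "((\<lambda>p. killed_density 1 (fst p) (snd p) / (fst p * snd p))
              \<longlongrightarrow> 2 / sqrt (2 * pi)) ?F"
    using killed_density_over_both by (simp add: case_prod_beta')
  have "((\<lambda>p. killed_density (t 0) (fst p) (x 0) / fst p * ?P
            * (killed_density (1 - t n) (x n) (snd p) / snd p)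
            / (killed_density 1 (fst p) (snd p) / (fst p * snd p)))
          \<longlongrightarrow> 2 * hitting_density (t 0) (x 0) * ?P * (2 * hitting_density (1 - t n) (x n))
              / (2 / sqrt (2 * pi))) ?F"
    by (intro tendsto_intros 1 2 3) auto
  also have "2 * hitting_density (t 0) (x 0) * ?P * (2 * hitting_density (1 - t n) (x n))
              / (2 / sqrt (2 * pi)) = excursion_density n t x"
    using x by (simp add: excursion_density_def)
  finally show ?thesis
    by (rule Lim_transform_eventually)
       (use pos in \<open>auto simp: conditioned_density_def case_prod_beta' elim!: eventually_mono\<close>)
qed

text \<open>
  A path \<open>e \<omega>\<close> is only relevant on \<open>[0,1]\<close>. Continuity of the paths and the finite-dimensional
  distributions determine the law of \<open>e\<close> on \<open>C[0,1]\<close>.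
\<close>
definition brownian_excursion :: "'w measure \<Rightarrow> ('w \<Rightarrow> real \<Rightarrow> real) \<Rightarrow> bool" where
  "brownian_excursion M e \<longleftrightarrow>
     (\<forall>\<omega>\<in>space M. continuous_on {0..1} (e \<omega>) \<and> e \<omega> 0 = 0 \<and> e \<omega> 1 = 0 \<and> (\<forall>t\<in>{0..1}. 0 \<le> e \<omega> t)) \<and>
     (AE \<omega> in M. \<forall>t\<in>{0<..<1}. 0 < e \<omega> t) \<and>
     (\<forall>n t. strict_mono_on {..n} t \<and> 0 < t 0 \<and> t n < 1 \<longrightarrow>
        distributed M (\<Pi>\<^sub>M i\<in>{..n}. lborel) (\<lambda>\<omega>. \<lambda>i\<in>{..n}. e \<omega> (t i))
          (\<lambda>x. ennreal (excursion_density n t x)))"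

section \<open>The function \<open>\<Lambda>\<close>\<close>

definition tree_distance :: "(real \<Rightarrow> real) \<Rightarrow> real \<Rightarrow> real \<Rightarrow> real" where
  "tree_distance g s t = g s + g t - 2 * (INF u\<in>{s..t}. g u)"

text \<open>
  Taking \<open>f = 1\<close> shows that \<open>L\<close> is integrable on \<open>[0,\<infinity>)\<close>, since the right-hand side is then \<open>1\<close>
  whereas the integral of a non-integrable function is \<open>0\<close> by convention. Test functions on
  \<open>[0,\<infinity>)\<close> are represented by their extensions to the real line.
\<close>
definition distance_profile :: "(real \<Rightarrow> real) \<Rightarrow> (real \<Rightarrow> real) \<Rightarrow> bool" where
  "distance_profile g L \<longleftrightarrow>
     continuous_on {0..} L \<and> (\<forall>x<0. L x = 0) \<and>
     (\<forall>f. f \<in> borel_measurable borel \<and> bounded (range f) \<longrightarrow>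
        (LINT x:{0..}|lborel. f x * L x) =
        2 * (LINT p:{(s, t). 0 < s \<and> s < t \<and> t < 1}|lborel \<Otimes>\<^sub>M lborel.
               f (tree_distance g (fst p) (snd p))))"

definition random_distance_profile ::
    "'w measure \<Rightarrow> ('w \<Rightarrow> real \<Rightarrow> real) \<Rightarrow> ('w \<Rightarrow> real \<Rightarrow> real) \<Rightarrow> bool" where
  "random_distance_profile M e \<Lambda> \<longleftrightarrow>
     (\<forall>x. (\<lambda>\<omega>. \<Lambda> \<omega> x) \<in> borel_measurable M) \<and>
     (AE \<omega> in M. distance_profile (e \<omega>) (\<Lambda> \<omega>))"

end

theory Submission
  imports Defs
begin

text \<open>
  Since \<open>\<Lambda>\<close> vanishes on the negative half-line, its derivative at \<open>0\<close> could only be \<open>0\<close>, and then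
  the measure of the pairs \<open>s < t\<close> with tree distance at most \<open>\<epsilon>\<close>, which is
  \<open>\<integral>\<^sub>0\<^sup>\<epsilon> \<Lambda> / 2\<close>, would be \<open>o(\<epsilon>\<^sup>2)\<close>. But pairs of nearby times already contribute order
  \<open>\<epsilon>\<^sup>2\<close>: cut \<open>[1/4, 3/4]\<close> into \<open>n\<close> intervals of length \<open>h = 1/(2n)\<close>. If the oscillation of the
  excursion on one of them is \<open>O(\<surd>h)\<close>, all its pairs have tree distance \<open>O(\<surd>h)\<close>. By a
  fourth-moment bound and dyadic chaining, every interval has this property with probability at
  least \<open>1/2\<close>. The fraction of such intervals would tend to \<open>0\<close> almost surely, while its
  expectation is at least \<open>1/2\<close>, which contradicts dominated convergence.
\<close>

section \<open>Fourth moments of the excursion increments\<close>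

lemma hitting_density_nonneg: "0 < t \<Longrightarrow> 0 \<le> x \<Longrightarrow> 0 \<le> hitting_density t x"
  by (simp add: hitting_density_def)

text \<open>Brownian scaling \<open>x = sqrt t * z\<close> reduces the claim to
  \<open>z * exp (- z^2 / 2) \<le> 1\<close>, which follows from
  \<open>z \<le> 1 + z^2 / 2 \<le> exp (z^2 / 2)\<close>.\<close>

lemma hitting_density_le:
  assumes t: "0 < t"
  shows "hitting_density t x \<le> 1 / t"
proof -
  define z where "z = x / sqrt t"
  have x: "x = sqrt t * z" and st: "sqrt t > 0" "sqrt t * sqrt t = t"
    using t by (auto simp: z_def)
  have "z \<le> 1 + z\<^sup>2 / 2"
    using zero_le_power2[of "z - 1"] by (simp add: power2_eq_square algebra_simps)
  also have "\<dots> \<le> exp (z\<^sup>2 / 2)"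
    by (rule exp_ge_add_one_self)
  finally have z: "z * exp (- (z\<^sup>2 / 2)) \<le> 1"
    by (simp add: exp_minus field_simps)
  have "hitting_density t x = 1 / t * (1 / sqrt (2 * pi) * (z * exp (- (z\<^sup>2 / 2))))"
    using t st by (simp add: hitting_density_def normal_density_def x real_sqrt_mult power_mult_distrib field_simps)
  also have "1 / sqrt (2 * pi) * (z * exp (- (z\<^sup>2 / 2))) \<le> 1 / sqrt (2 * pi) * 1"
    by (intro mult_left_mono z) auto
  also have "1 / sqrt (2 * pi) * 1 \<le> 1"
    using pi_gt3 by (simp add: real_le_rsqrt)
  finally show ?thesis
    using t by (simp add: mult_left_mono divide_right_mono)
qed

lemma killed_density_le: "killed_density t x y \<le> normal_density x (sqrt t) y"
  by (simp add: killed_density_def)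

lemma killed_density_nonneg:
  assumes "0 < t" "0 \<le> x" "0 \<le> y"
  shows "0 \<le> killed_density t x y"
  using assms by (simp add: killed_density_sinh)

text \<open>The killed kernel is at most the Gaussian one, and the last hitting density is at most
  \<open>1 / (1 - t)\<close>. The first hitting density is kept, since its Gaussian factor makes the
  bound integrable in \<open>x 0\<close>. The absolute value keeps the right-hand side nonnegative
  where the excursion density is 0.\<close>

lemma excursion_density_pair_le:
  assumes "0 < s" "s < t" "t < 1"
  shows "excursion_density 1 (\<lambda>i. if i = 0 then s else t) x
    \<le> 2 * sqrt (2 * pi) * (normal_density 0 (sqrt s) (x 0) * \<bar>x 0\<bar> / s)
        * normal_density (x 0) (sqrt (t - s)) (x 1) * (1 / (1 - t))"
proof (cases "0 < x 0 \<and> 0 < x 1")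
  case True
  have "2 * sqrt (2 * pi) * hitting_density s (x 0) * killed_density (t - s) (x 0) (x 1)
       * hitting_density (1 - t) (x 1)
     \<le> 2 * sqrt (2 * pi) * hitting_density s (x 0) * normal_density (x 0) (sqrt (t - s)) (x 1)
       * (1 / (1 - t))"
    using True assms
    by (intro mult_mono mult_nonneg_nonneg killed_density_le hitting_density_le
          hitting_density_nonneg killed_density_nonneg order.refl) auto
  moreover have "excursion_density 1 (\<lambda>i. if i = 0 then s else t) x =
      2 * sqrt (2 * pi) * hitting_density s (x 0) * killed_density (t - s) (x 0) (x 1)
       * hitting_density (1 - t) (x 1)"
    using True by (auto simp: excursion_density_def le_Suc_eq)
  ultimately show ?thesis
    using True by (simp add: hitting_density_def mult_ac)
next
  case False
  then have "excursion_density 1 (\<lambda>i. if i = 0 then s else t) x = 0"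
    by (auto simp: excursion_density_def)
  then show ?thesis
    using assms by simp
qed

text \<open>The Gaussian majorant can be integrated exactly. Integrating out the later position
  gives the fourth moment \<open>3 * (t - s)^2\<close>; integrating out the earlier one gives the
  first absolute moment \<open>sqrt s * sqrt (2 / pi)\<close>. The factor \<open>c\<close> collects
  the remaining constants. The order \<open>(t - s)^2\<close> is the same as for Brownian
  motion.\<close>

lemma excursion_increment_moment:
  assumes e: "brownian_excursion M e" and st: "0 < s" "s < t" "t < 1"
  shows "(\<integral>\<^sup>+\<omega>. ennreal ((e \<omega> t - e \<omega> s) ^ 4) \<partial>M) \<le> ennreal (12 * (t - s)\<^sup>2 / (sqrt s * (1 - t)))"
proof -
  interpret lb: product_sigma_finite "\<lambda>_::nat. lborel :: real measure"
    by unfold_locales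
  define T where "T = (\<lambda>i::nat. if i = 0 then s else t)"
  define X where "X = (\<lambda>\<omega>. \<lambda>i\<in>{..1::nat}. e \<omega> (T i))"
  define c where "c = 2 * sqrt (2 * pi) / (s * (1 - t))"
  define f where "f u v = ennreal (c * (normal_density 0 (sqrt s) u * \<bar>u\<bar>))
      * ennreal (normal_density u (sqrt (t - s)) v * (v - u) ^ 4)" for u v
  have [measurable]: "(\<lambda>z. f (fst z) (snd z)) \<in> borel_measurable (lborel \<Otimes>\<^sub>M lborel)"
    unfolding f_def normal_density_def by measurable
  have c: "0 \<le> c"
    using st by (simp add: c_def)
  have "strict_mono_on {..1} T \<and> 0 < T 0 \<and> T 1 < 1"
    using st by (auto simp: strict_mono_on_def T_def)
  then have D: "distributed M (\<Pi>\<^sub>M i\<in>{..1}. lborel) X (\<lambda>x. ennreal (excursion_density 1 T x))"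
    using e unfolding brownian_excursion_def X_def by blast
  have "(\<integral>\<^sup>+\<omega>. ennreal ((e \<omega> t - e \<omega> s) ^ 4) \<partial>M) = (\<integral>\<^sup>+\<omega>. ennreal ((X \<omega> 1 - X \<omega> 0) ^ 4) \<partial>M)"
    by (simp add: X_def T_def)
  also have "\<dots> = (\<integral>\<^sup>+x. ennreal (excursion_density 1 T x) * ennreal ((x 1 - x 0) ^ 4) \<partial>(\<Pi>\<^sub>M i\<in>{..1::nat}. lborel))"
    by (rule distributed_nn_integral[OF D, symmetric]) (measurable; simp)
  also have "\<dots> \<le> (\<integral>\<^sup>+x. f (x 0) (x 1) \<partial>(\<Pi>\<^sub>M i\<in>{..1::nat}. lborel))"
  proof (rule nn_integral_mono)
    fix x :: "nat \<Rightarrow> real"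
    have "excursion_density 1 T x * (x 1 - x 0) ^ 4
        \<le> c * (normal_density 0 (sqrt s) (x 0) * \<bar>x 0\<bar>)
          * (normal_density (x 0) (sqrt (t - s)) (x 1) * (x 1 - x 0) ^ 4)"
      using mult_right_mono[OF excursion_density_pair_le[OF st, of x], of "(x 1 - x 0) ^ 4"]
      by (simp add: c_def T_def mult_ac)
    then have "ennreal (excursion_density 1 T x * (x 1 - x 0) ^ 4)
        \<le> ennreal (c * (normal_density 0 (sqrt s) (x 0) * \<bar>x 0\<bar>)
          * (normal_density (x 0) (sqrt (t - s)) (x 1) * (x 1 - x 0) ^ 4))"
      by (rule ennreal_leI)
    then show "ennreal (excursion_density 1 T x) * ennreal ((x 1 - x 0) ^ 4) \<le> f (x 0) (x 1)"
      using c by (simp add: f_def ennreal_mult'' ennreal_mult' del: ennreal_mult)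
  qed
  also have "{..1::nat} = {0, 1}"
    by auto
  also have "(\<integral>\<^sup>+x. f (x 0) (x 1) \<partial>(\<Pi>\<^sub>M i\<in>{0, 1::nat}. lborel)) =
      (\<integral>\<^sup>+z. f (fst z) (snd z) \<partial>(lborel \<Otimes>\<^sub>M lborel))"
    by (rule lb.product_nn_integral_pair) (simp_all add: case_prod_beta')
  also have "\<dots> = (\<integral>\<^sup>+u. \<integral>\<^sup>+v. f u v \<partial>lborel \<partial>lborel)"
    by (subst lborel.nn_integral_fst[symmetric]) simp_all
  also have "\<dots> = (\<integral>\<^sup>+u. ennreal (c * (normal_density 0 (sqrt s) u * \<bar>u\<bar>)) * ennreal (3 * (t - s)\<^sup>2) \<partial>lborel)"
  proof (intro nn_integral_cong)
    fix u :: real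
    have pos: "0 < sqrt (t - s)" using st by simp
    note m = normal_moment_even[OF pos, of u 2]
    have "(\<integral>\<^sup>+v. ennreal (normal_density u (sqrt (t - s)) v * (v - u) ^ 4) \<partial>lborel) =
        ennreal (integral\<^sup>L lborel (\<lambda>v. normal_density u (sqrt (t - s)) v * (v - u) ^ 4))"
      using m by (intro nn_integral_eq_integral) (auto simp: has_bochner_integral_iff)
    also have "integral\<^sup>L lborel (\<lambda>v. normal_density u (sqrt (t - s)) v * (v - u) ^ 4) =
        fact (2 * 2) / ((2 / (sqrt (t - s))\<^sup>2) ^ 2 * fact 2)"
      using m by (simp add: has_bochner_integral_iff)
    also have "\<dots> = 3 * (t - s)\<^sup>2"
      using st by (simp add: fact_numeral field_simps)
    finally show "(\<integral>\<^sup>+v. f u v \<partial>lborel) = ennreal (c * (normal_density 0 (sqrt s) u * \<bar>u\<bar>)) * ennreal (3 * (t - s)\<^sup>2)"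
      unfolding f_def by (subst nn_integral_cmult) (auto simp: normal_density_def)
  qed
  also have "\<dots> = (\<integral>\<^sup>+u. ennreal (normal_density 0 (sqrt s) u * \<bar>u\<bar>) \<partial>lborel) * ennreal (c * (3 * (t - s)\<^sup>2))"
    using c by (subst nn_integral_multc[symmetric])
      (auto simp flip: ennreal_mult' ennreal_mult'' simp: mult_ac intro!: nn_integral_cong)
  also have "(\<integral>\<^sup>+u. ennreal (normal_density 0 (sqrt s) u * \<bar>u\<bar>) \<partial>lborel) = ennreal (sqrt s * sqrt (2 / pi))"
  proof -
    have pos: "0 < sqrt s" using st by simp
    note m = normal_moment_abs_odd[OF pos, of 0 0]
    have "(\<integral>\<^sup>+u. ennreal (normal_density 0 (sqrt s) u * \<bar>u\<bar>) \<partial>lborel) =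
        ennreal (integral\<^sup>L lborel (\<lambda>u. normal_density 0 (sqrt s) u * \<bar>u\<bar>))"
      using m by (intro nn_integral_eq_integral) (auto simp: has_bochner_integral_iff)
    with m show ?thesis
      by (simp add: has_bochner_integral_iff)
  qed
  also have "ennreal (sqrt s * sqrt (2 / pi)) * ennreal (c * (3 * (t - s)\<^sup>2)) =
      ennreal (sqrt s * sqrt (2 / pi) * (c * (3 * (t - s)\<^sup>2)))"
    using c st by (simp add: ennreal_mult)
  also have "sqrt s * sqrt (2 / pi) * (c * (3 * (t - s)\<^sup>2)) = 12 * (t - s)\<^sup>2 / (sqrt s * (1 - t))"
  proof -
    have "sqrt (2 / pi) * sqrt (2 * pi) = 2"
      by (simp flip: real_sqrt_mult)
    moreover have "sqrt s * sqrt (2 / pi) * (c * (3 * (t - s)\<^sup>2)) =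
       (sqrt (2 / pi) * sqrt (2 * pi)) * (6 * (t - s)\<^sup>2 * (sqrt s / s) / (1 - t))"
      by (simp add: c_def field_simps)
    moreover have "sqrt s / s = 1 / sqrt s"
      using st by (simp add: field_simps)
    ultimately show ?thesis
      by simp
  qed
  finally show ?thesis .
qed

text \<open>Measurability is part of \<open>distributed\<close>, so it can be read off the one-point
  marginal, which is available at interior times.\<close>

lemma excursion_measurable:
  assumes e: "brownian_excursion M e" and t: "0 < t" "t < 1"
  shows "(\<lambda>\<omega>. e \<omega> t) \<in> borel_measurable M"
proof -
  have "distributed M (\<Pi>\<^sub>M i\<in>{..0}. lborel) (\<lambda>\<omega>. \<lambda>i\<in>{..0}. e \<omega> t) (\<lambda>x. ennreal (excursion_density 0 (\<lambda>_. t) x))"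
    by (rule e[unfolded brownian_excursion_def, THEN conjunct2, THEN conjunct2, rule_format, of 0 "\<lambda>_. t"])
       (use t in \<open>auto simp: strict_mono_on_def\<close>)
  then have "(\<lambda>\<omega>. \<lambda>i\<in>{..0::nat}. e \<omega> t) \<in> measurable M (\<Pi>\<^sub>M i\<in>{..0}. lborel)"
    by (rule distributed_measurable)
  from measurable_compose[OF this measurable_component_singleton[of 0]] show ?thesis
    by simp
qed

text \<open>Markov's inequality for the fourth power. On \<open>[1/4, 3/4]\<close> the denominator
  \<open>sqrt s * (1 - t)\<close> is at least \<open>1/8\<close>, which turns 12 into 96.\<close>

lemma excursion_increment_tail:
  assumes M: "prob_space M" and e: "brownian_excursion M e"
    and st: "1/4 \<le> s" "s < t" "t \<le> 3/4" and b: "0 < b"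
  shows "measure M {\<omega>\<in>space M. b < \<bar>e \<omega> t - e \<omega> s\<bar>} \<le> 96 * (t - s)\<^sup>2 / b ^ 4"
proof -
  interpret prob_space M by fact
  have [measurable]: "(\<lambda>\<omega>. e \<omega> t) \<in> borel_measurable M" "(\<lambda>\<omega>. e \<omega> s) \<in> borel_measurable M"
    using st by (auto intro!: excursion_measurable[OF e])
  have "ennreal (b ^ 4) * emeasure M {\<omega>\<in>space M. b < \<bar>e \<omega> t - e \<omega> s\<bar>} =
      (\<integral>\<^sup>+\<omega>. ennreal (b ^ 4) * indicator {\<omega>\<in>space M. b < \<bar>e \<omega> t - e \<omega> s\<bar>} \<omega> \<partial>M)"
    by (subst nn_integral_cmult_indicator) simp_all
  also have "\<dots> \<le> (\<integral>\<^sup>+\<omega>. ennreal ((e \<omega> t - e \<omega> s) ^ 4) \<partial>M)"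
  proof (intro nn_integral_mono)
    fix \<omega>
    have "b ^ 4 \<le> (e \<omega> t - e \<omega> s) ^ 4" if "b < \<bar>e \<omega> t - e \<omega> s\<bar>"
      using that b power_mono[of b "\<bar>e \<omega> t - e \<omega> s\<bar>" 4] by simp
    then show "ennreal (b ^ 4) * indicator {\<omega>\<in>space M. b < \<bar>e \<omega> t - e \<omega> s\<bar>} \<omega> \<le> ennreal ((e \<omega> t - e \<omega> s) ^ 4)"
      by (auto simp: indicator_def intro!: ennreal_leI)
  qed
  also have "\<dots> \<le> ennreal (12 * (t - s)\<^sup>2 / (sqrt s * (1 - t)))"
    using st by (intro excursion_increment_moment[OF e]) auto
  also have "\<dots> \<le> ennreal (96 * (t - s)\<^sup>2)"
  proof (rule ennreal_leI)
    have "1 / 2 \<le> sqrt s"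
      using st by (intro real_le_rsqrt) (simp add: power2_eq_square)
    then have "1/2 * (1/4) \<le> sqrt s * (1 - t)"
      using st by (intro mult_mono) auto
    then have "12 * (t - s)\<^sup>2 / (sqrt s * (1 - t)) \<le> 12 * (t - s)\<^sup>2 / (1 / 8)"
      by (intro divide_left_mono) auto
    then show "12 * (t - s)\<^sup>2 / (sqrt s * (1 - t)) \<le> 96 * (t - s)\<^sup>2"
      by simp
  qed
  finally have "b ^ 4 * measure M {\<omega>\<in>space M. b < \<bar>e \<omega> t - e \<omega> s\<bar>} \<le> 96 * (t - s)\<^sup>2"
    using b by (simp add: emeasure_eq_measure ennreal_mult[symmetric])
  then show ?thesis
    using b by (simp add: field_simps)
qed

section \<open>Dyadic chaining for a deterministic path\<close>

text \<open>Each grid point is reached from \<open>a\<close> with at most one increment per level: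
  an even point of level \<open>j + 1\<close> already belongs to level \<open>j\<close>, and an odd
  one is a single increment away from its even left neighbour.\<close>

lemma dyadic_chaining_grid:
  fixes g :: "real \<Rightarrow> real"
  assumes "\<And>j i. i < 2 ^ j \<Longrightarrow> \<bar>g (a + real (Suc i) * h / 2 ^ j) - g (a + real i * h / 2 ^ j)\<bar> \<le> c * r ^ j"
    and "i \<le> 2 ^ j" and "0 \<le> c" "0 \<le> r"
  shows "\<bar>g (a + real i * h / 2 ^ j) - g a\<bar> \<le> c * (\<Sum>l\<le>j. r ^ l)"
  using assms(2)
proof (induction j arbitrary: i)
  case 0
  then have "i = 0 \<or> i = 1" by auto
  then show ?case
    using assms(1)[of 0 0] assms(3) by auto
next
  case (Suc j)
  have even_case: "\<bar>g (a + real i * h / 2 ^ Suc j) - g a\<bar> \<le> c * (\<Sum>l\<le>j. r ^ l)"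
    if "even i" "i \<le> 2 ^ Suc j" for i
    using that Suc.IH[of "i div 2"] by (auto elim!: evenE)
  show ?case
  proof (cases "even i")
    case True
    then show ?thesis
      using even_case[of i] Suc.prems assms(3,4) by (simp add: distrib_left add_increasing2)
  next
    case False
    then obtain m where m: "i = Suc (2 * m)"
      by (auto elim: oddE)
    have "2 * m \<noteq> 2 ^ Suc j" "2 * m < 2 ^ Suc j"
      using Suc.prems m by auto
    then have "\<bar>g (a + real i * h / 2 ^ Suc j) - g (a + real (2 * m) * h / 2 ^ Suc j)\<bar> \<le> c * r ^ Suc j"
      using assms(1)[of "2 * m" "Suc j"] m by simp
    moreover have "\<bar>g (a + real (2 * m) * h / 2 ^ Suc j) - g a\<bar> \<le> c * (\<Sum>l\<le>j. r ^ l)"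
      using \<open>2 * m < 2 ^ Suc j\<close> by (intro even_case) auto
    ultimately show ?thesis
      by (simp add: distrib_left del: power_Suc of_nat_mult)
  qed
qed

text \<open>The grid bound is at most the full geometric series on every level, and continuity
  carries it over to the limits of grid points, that is, to the whole interval.\<close>

lemma dyadic_chaining:
  fixes g :: "real \<Rightarrow> real"
  assumes inc: "\<And>j i. i < 2 ^ j \<Longrightarrow> \<bar>g (a + real (Suc i) * h / 2 ^ j) - g (a + real i * h / 2 ^ j)\<bar> \<le> c * r ^ j"
    and c: "0 \<le> c" and r: "0 \<le> r" "r < 1" and h: "0 < h"
    and cont: "continuous_on {a..a+h} g" and x: "x \<in> {a..a+h}"
  shows "\<bar>g x - g a\<bar> \<le> c / (1 - r)"
proof -
  \<comment> \<open>\<open>y j\<close> is the last grid point of level \<open>j\<close> that does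
    not exceed \<open>x\<close>; it is within \<open>h / 2^j\<close> of \<open>x\<close>. For
    \<open>x = a + h\<close> the index is \<open>2^j\<close>, which the grid lemma admits.\<close>
  define i where "i j = nat \<lfloor>(x - a) / h * 2 ^ j\<rfloor>" for j :: nat
  define y where "y j = a + real (i j) * h / 2 ^ j" for j
  have i_real: "real (i j) = of_int \<lfloor>(x - a) / h * 2 ^ j\<rfloor>" for j
    using x h by (simp add: i_def)
  have le: "real (i j) \<le> (x - a) / h * 2 ^ j" for j
    unfolding i_real by linarith
  have ge: "(x - a) / h * 2 ^ j - 1 \<le> real (i j)" for j
    unfolding i_real by linarith
  have yx: "y j \<le> x" for j
    using le[of j] h by (simp add: y_def field_simps)
  have yah: "y j \<le> a + h" for j
    using yx[of j] x by simp
  have xy: "x - h * (1/2) ^ j \<le> y j" for j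
  proof -
    have "x - h * (1/2) ^ j = a + ((x - a) / h * 2 ^ j - 1) * (h / 2 ^ j)"
      using h by (simp add: power_one_over field_simps)
    also have "\<dots> \<le> a + real (i j) * (h / 2 ^ j)"
      using ge[of j] h by (intro add_left_mono mult_right_mono) auto
    finally show ?thesis
      by (simp add: y_def)
  qed
  have ay: "a \<le> y j" for j
    using h by (simp add: y_def)
  have i_le: "i j \<le> 2 ^ j" for j
  proof -
    note le[of j]
    also have "(x - a) / h * 2 ^ j \<le> 1 * 2 ^ j"
      using x h by (intro mult_right_mono) auto
    finally show ?thesis
      by simp
  qed
  have "y \<longlonglongrightarrow> x"
  proof (rule tendsto_sandwich)
    show "(\<lambda>j. x - h * (1/2) ^ j) \<longlonglongrightarrow> x"
      by (auto intro!: tendsto_eq_intros LIMSEQ_power_zero)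
  qed (use xy yx in auto)
  then have "(\<lambda>j. g (y j)) \<longlonglongrightarrow> g x"
    using ay yah x by (intro continuous_on_tendsto_compose[OF cont]) auto
  then have "(\<lambda>j. \<bar>g (y j) - g a\<bar>) \<longlonglongrightarrow> \<bar>g x - g a\<bar>"
    by (intro tendsto_intros)
  moreover have "\<bar>g (y j) - g a\<bar> \<le> c / (1 - r)" for j
  proof -
    have "\<bar>g (y j) - g a\<bar> \<le> c * (\<Sum>l\<le>j. r ^ l)"
      unfolding y_def using inc i_le c r by (intro dyadic_chaining_grid) auto
    also have "(\<Sum>l\<le>j. r ^ l) \<le> (\<Sum>l. r ^ l)"
      using r by (intro sum_le_suminf summable_geometric) auto
    also have "(\<Sum>l. r ^ l) = 1 / (1 - r)"
      using r by (intro suminf_geometric) auto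
    finally show ?thesis
      using c by (simp add: mult_left_mono)
  qed
  ultimately show ?thesis
    by (intro LIMSEQ_le_const2) auto
qed

section \<open>Tree distance and the area of the close pairs\<close>

text \<open>Both endpoint values are at most \<open>g a + B\<close> and the infimum is at least
  \<open>g a - B\<close>; the two gaps of \<open>2 * B\<close> add up.\<close>

lemma tree_distance_le:
  assumes "\<And>x. x \<in> {a..b} \<Longrightarrow> \<bar>g x - g a\<bar> \<le> B" and "a \<le> s" "s \<le> t" "t \<le> b"
  shows "tree_distance g s t \<le> 4 * B"
proof -
  have "g a - B \<le> (INF u\<in>{s..t}. g u)"
  proof (rule cINF_greatest)
    fix u assume "u \<in> {s..t}"
    then show "g a - B \<le> g u"
      using assms(1)[of u] assms(2-4) by auto
  qed (use assms in auto)
  then show ?thesis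
    using assms(1)[of s] assms(1)[of t] assms(2-4) by (simp add: tree_distance_def)
qed

text \<open>The infimum runs over an uncountable set that varies with \<open>(s, t)\<close>. Writing
  \<open>u = s + v * (t - s)\<close> with \<open>v\<close> in \<open>[0, 1]\<close> makes the index
  set fixed, and each superlevel set of the infimum becomes the trace on the triangle of an
  intersection of closed sets.\<close>

lemma tree_distance_measurable:
  fixes g :: "real \<Rightarrow> real"
  assumes g: "continuous_on {0..1} g"
  shows "(\<lambda>p. tree_distance g (fst p) (snd p))
    \<in> borel_measurable (restrict_space (lborel \<Otimes>\<^sub>M lborel) {(s, t). 0 < s \<and> s < t \<and> t < 1})"
    (is "_ \<in> borel_measurable (restrict_space _ ?A)")
proof -
  \<comment> \<open>Clamping the argument extends \<open>g\<close> continuously to the whole line,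
    so that these sets are closed in the whole plane.\<close>
  define G where "G x = g (min 1 (max 0 x))" for x
  have G: "G x = g x" if "0 \<le> x" "x \<le> 1" for x
    using that by (simp add: G_def)
  have contG: "continuous_on UNIV G"
    unfolding G_def
    by (rule continuous_on_compose2[OF g]) (auto intro!: continuous_intros)
  have sets: "sets (lborel \<Otimes>\<^sub>M lborel :: (real \<times> real) measure) = sets borel"
    by (simp only: lborel_prod sets_lborel)
  have [measurable]: "G \<in> borel_measurable borel"
    using contG by (rule borel_measurable_continuous_onI)
  define I where "I p = (INF u\<in>{fst p..snd p}. g u)" for p
  have "I \<in> borel_measurable (restrict_space (lborel \<Otimes>\<^sub>M lborel) ?A)"
    unfolding borel_measurable_iff_ge
  proof
    fix c :: real
    have "{p \<in> space (restrict_space (lborel \<Otimes>\<^sub>M lborel) ?A). c \<le> I p} =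
        ?A \<inter> (\<Inter>v\<in>{0..1}. {p. c \<le> G (fst p + v * (snd p - fst p))})"
      (is "_ = ?R")
    proof (intro set_eqI)
      fix p :: "real \<times> real"
      obtain s t where p: "p = (s, t)" by force
      have "c \<le> I p \<longleftrightarrow> (\<forall>v\<in>{0..1}. c \<le> G (s + v * (t - s)))" if st: "0 < s" "s < t" "t < 1"
      proof -
        have "compact (g ` {s..t})"
          using st by (intro compact_continuous_image continuous_on_subset[OF g]) auto
        then have "bdd_below (g ` {s..t})"
          by (intro bounded_imp_bdd_below compact_imp_bounded)
        then have "c \<le> I p \<longleftrightarrow> (\<forall>u\<in>{s..t}. c \<le> g u)"
          using st by (subst le_cINF_iff[of "{s..t}" g c, symmetric]) (auto simp: I_def p)
        also have "\<dots> \<longleftrightarrow> (\<forall>v\<in>{0..1}. c \<le> G (s + v * (t - s)))"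
        proof safe
          fix v :: real assume v: "v \<in> {0..1}" and *: "\<forall>u\<in>{s..t}. c \<le> g u"
          have "0 \<le> v * (t - s)" "v * (t - s) \<le> t - s"
            using v st by (auto intro!: mult_left_le_one_le)
          then have "s + v * (t - s) \<in> {s..t}"
            by auto
          with * st show "c \<le> G (s + v * (t - s))"
            by (subst G) auto
        next
          fix u assume u: "u \<in> {s..t}" and *: "\<forall>v\<in>{0..1}. c \<le> G (s + v * (t - s))"
          have "(u - s) / (t - s) \<in> {0..1}"
            using u st by auto
          with * have "c \<le> G (s + (u - s) / (t - s) * (t - s))"
            by blast
          then show "c \<le> g u"
            using u st by (simp add: G)
        qed
        finally show ?thesis .
      qed
      then show "p \<in> {p \<in> space (restrict_space (lborel \<Otimes>\<^sub>M lborel) ?A). c \<le> I p} \<longleftrightarrow> p \<in> ?R"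
        by (auto simp: p space_restrict_space space_pair_measure)
    qed
    moreover have "closed (\<Inter>v\<in>{0..1}. {p. c \<le> G (fst p + v * (snd p - fst p))})"
      by (intro closed_INT ballI closed_Collect_le continuous_on_const
            continuous_on_compose2[OF contG]) (auto intro!: continuous_intros)
    then have "(\<Inter>v\<in>{0..1}. {p. c \<le> G (fst p + v * (snd p - fst p))}) \<in> sets (lborel \<Otimes>\<^sub>M lborel)"
      unfolding sets by (rule borel_closed)
    ultimately show "{p \<in> space (restrict_space (lborel \<Otimes>\<^sub>M lborel) ?A). c \<le> I p}
        \<in> sets (restrict_space (lborel \<Otimes>\<^sub>M lborel) ?A)"
      by (auto simp: sets_restrict_space)
  qed
  moreover have "(\<lambda>p. G (fst p) + G (snd p)) \<in> borel_measurable (restrict_space (lborel \<Otimes>\<^sub>M lborel) ?A)"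
    by (intro measurable_restrict_space1) measurable
  ultimately have "(\<lambda>p. G (fst p) + G (snd p) - 2 * I p) \<in> borel_measurable (restrict_space (lborel \<Otimes>\<^sub>M lborel) ?A)"
    by measurable
  then show ?thesis
    by (rule measurable_cong[THEN iffD1, rotated])
       (auto simp: tree_distance_def G I_def space_restrict_space)
qed

definition close_pairs :: "(real \<Rightarrow> real) \<Rightarrow> real \<Rightarrow> (real \<times> real) set" where
  "close_pairs g \<epsilon> = {(s, t). 0 < s \<and> s < t \<and> t < 1 \<and> tree_distance g s t \<le> \<epsilon>}"

text \<open>Finiteness comes from the inclusion in the unit square; it allows \<open>measure\<close>
  to be compared with that of subsets.\<close>

lemma close_pairs_fmeasurable:
  assumes g: "continuous_on {0..1} g"
  shows "close_pairs g \<epsilon> \<in> fmeasurable (lborel \<Otimes>\<^sub>M lborel)"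
proof -
  let ?A = "{(s::real, t). 0 < s \<and> s < t \<and> t < 1}"
  have A: "?A \<in> sets (lborel \<Otimes>\<^sub>M lborel)"
  proof -
    have "{p::real \<times> real \<in> space (lborel \<Otimes>\<^sub>M lborel). 0 < fst p \<and> fst p < snd p \<and> snd p < 1} \<in> sets (lborel \<Otimes>\<^sub>M lborel)"
      by measurable
    then show ?thesis
      by (simp add: space_pair_measure case_prod_beta')
  qed
  have "{p \<in> space (restrict_space (lborel \<Otimes>\<^sub>M lborel) ?A). tree_distance g (fst p) (snd p) \<le> \<epsilon>}
      \<in> sets (restrict_space (lborel \<Otimes>\<^sub>M lborel) ?A)"
    using tree_distance_measurable[OF g] by measurable
  moreover have "{p \<in> space (restrict_space (lborel \<Otimes>\<^sub>M lborel) ?A). tree_distance g (fst p) (snd p) \<le> \<epsilon>} =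
      close_pairs g \<epsilon>"
    by (auto simp: close_pairs_def space_restrict_space space_pair_measure)
  ultimately have "close_pairs g \<epsilon> \<in> sets (lborel \<Otimes>\<^sub>M lborel)"
    using A by (simp add: sets_restrict_space_iff)
  moreover have "close_pairs g \<epsilon> \<subseteq> {0..1} \<times> {0..1}"
    by (auto simp: close_pairs_def)
  moreover have "{0..1::real} \<times> {0..1::real} \<in> fmeasurable (lborel \<Otimes>\<^sub>M lborel)"
    by (rule fmeasurableI) (simp_all add: lborel.emeasure_pair_measure_Times)
  ultimately show ?thesis
    using fmeasurableI2 by blast
qed

text \<open>Every interval with index in \<open>S\<close> contributes a square of area
  \<open>h^2 / 4\<close>: \<open>s\<close> ranges over its left half and \<open>t\<close> over its
  right half. This forces \<open>s < t\<close>, and half-open sides keep the squares of different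
  intervals disjoint.\<close>

lemma measure_close_pairs_ge:
  assumes g: "continuous_on {0..1} g" and S: "S \<subseteq> {..<n}"
    and a: "0 < a" "a + real n * h < 1" and h: "0 < h"
    and close: "\<And>k s t. \<lbrakk>k \<in> S; a + real k * h \<le> s; s \<le> t; t \<le> a + real k * h + h\<rbrakk> \<Longrightarrow> tree_distance g s t \<le> \<epsilon>"
  shows "real (card S) * h\<^sup>2 / 4 \<le> measure (lborel \<Otimes>\<^sub>M lborel) (close_pairs g \<epsilon>)"
proof -
  define R where "R k = {a + real k * h..<a + real k * h + h/2} \<times> {a + real k * h + h/2..<a + real k * h + h}" for k
  have fin: "finite S"
    using S finite_subset by blast
  have sets: "R k \<in> sets (lborel \<Otimes>\<^sub>M lborel)" for k
    by (simp add: R_def)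
  have em: "emeasure (lborel \<Otimes>\<^sub>M lborel) (R k) = ennreal (h\<^sup>2 / 4)" for k
    using h by (simp add: R_def lborel.emeasure_pair_measure_Times power2_eq_square field_simps flip: ennreal_mult)
  then have mR: "measure (lborel \<Otimes>\<^sub>M lborel) (R k) = h\<^sup>2 / 4" for k
    by (simp add: measure_def)
  have "R k \<inter> R l = {}" if "k < l" for k l
  proof -
    have "(real k + 1) * h \<le> real l * h"
      using that h by (intro mult_right_mono) auto
    then show ?thesis
      using h by (auto simp: R_def algebra_simps)
  qed
  then have disj: "disjoint_family_on R S"
    unfolding disjoint_family_on_def by (metis inf_commute linorder_neqE_nat)
  have "real (card S) * h\<^sup>2 / 4 = (\<Sum>k\<in>S. measure (lborel \<Otimes>\<^sub>M lborel) (R k))"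
    by (simp add: mR)
  also have "\<dots> = measure (lborel \<Otimes>\<^sub>M lborel) (\<Union>k\<in>S. R k)"
    using fin sets disj em by (intro measure_finite_Union[symmetric]) auto
  also have "\<dots> \<le> measure (lborel \<Otimes>\<^sub>M lborel) (close_pairs g \<epsilon>)"
  proof (rule measure_mono_fmeasurable)
    show "(\<Union>k\<in>S. R k) \<subseteq> close_pairs g \<epsilon>"
    proof clarify
      fix k s t assume k: "k \<in> S" and st: "(s, t) \<in> R k"
      have "0 \<le> real k * h" and kn: "(real k + 1) * h \<le> real n * h"
        using k S h by (auto intro!: mult_right_mono)
      then have "a \<le> s"
        using st unfolding R_def mem_Times_iff atLeastLessThan_iff fst_conv by linarith
      with kn show "(s, t) \<in> close_pairs g \<epsilon>"
        using st a close[OF k, of s t] by (auto simp: R_def close_pairs_def algebra_simps)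
    qed
  qed (use fin sets close_pairs_fmeasurable[OF g] in auto)
  finally show ?thesis .
qed

section \<open>Behaviour of the profile near 0\<close>

text \<open>Testing the profile with the indicator of \<open>{..\<epsilon>}\<close> turns the double
  integral into the measure of the close pairs and the other side into the integral of
  \<open>L\<close> over \<open>{0..\<epsilon>}\<close>.\<close>

lemma measure_close_pairs_le:
  assumes L: "distance_profile g L" and \<epsilon>: "0 \<le> \<epsilon>" and b: "\<And>x. 0 \<le> x \<Longrightarrow> x \<le> \<epsilon> \<Longrightarrow> \<bar>L x\<bar> \<le> b"
  shows "2 * measure (lborel \<Otimes>\<^sub>M lborel) (close_pairs g \<epsilon>) \<le> b * \<epsilon>"
proof -
  let ?A = "{(s::real, t). 0 < s \<and> s < t \<and> t < 1}"
  \<comment> \<open>With a half-line instead of \<open>{0..\<epsilon>}\<close> the sign of the tree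
    distance need not be examined; negative \<open>x\<close> are removed by the integration domain
    \<open>{0..}\<close>.\<close>
  let ?f = "indicator {..\<epsilon>} :: real \<Rightarrow> real"
  have "?f \<in> borel_measurable borel \<and> bounded (range ?f)"
    by (auto simp: bounded_iff indicator_def intro!: exI[of _ 1])
  then have "(LINT x:{0..}|lborel. ?f x * L x) =
      2 * (LINT p:?A|lborel \<Otimes>\<^sub>M lborel. ?f (tree_distance g (fst p) (snd p)))"
    using L unfolding distance_profile_def by blast
  also have "(LINT p:?A|lborel \<Otimes>\<^sub>M lborel. ?f (tree_distance g (fst p) (snd p))) =
      (\<integral>p. indicator (close_pairs g \<epsilon>) p \<partial>(lborel \<Otimes>\<^sub>M lborel))"
    unfolding set_lebesgue_integral_def
    by (intro Bochner_Integration.integral_cong) (auto simp: close_pairs_def indicator_def)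
  also have "\<dots> = measure (lborel \<Otimes>\<^sub>M lborel) (close_pairs g \<epsilon>)"
    by (simp add: space_pair_measure)
  finally have "2 * measure (lborel \<Otimes>\<^sub>M lborel) (close_pairs g \<epsilon>) = (LINT x:{0..}|lborel. ?f x * L x)" ..
  also have "(LINT x:{0..}|lborel. ?f x * L x) = (LINT x:{0..\<epsilon>}|lborel. L x)"
    unfolding set_lebesgue_integral_def
    by (intro Bochner_Integration.integral_cong) (auto simp: indicator_def)
  also have "(LINT x:{0..\<epsilon>}|lborel. L x) \<le> (LINT x:{0..\<epsilon>}|lborel. b)"
  proof (rule set_integral_mono)
    have "continuous_on {0..\<epsilon>} L"
      using L unfolding distance_profile_def by (auto intro: continuous_on_subset)
    then show "set_integrable lborel {0..\<epsilon>} L"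
      by (rule borel_integrable_atLeastAtMost')
    show "set_integrable lborel {0..\<epsilon>} (\<lambda>_. b)"
      by (intro borel_integrable_atLeastAtMost') auto
  qed (use b in force)
  also have "\<dots> = b * \<epsilon>"
    using \<epsilon> by (simp add: set_lebesgue_integral_def)
  finally show ?thesis .
qed

text \<open>Left limits decide everything: continuity at 0 gives \<open>L 0 = 0\<close>, and then
  the difference quotients from the left, all 0, give \<open>D = 0\<close>. Hence
  \<open>L x / x\<close> tends to 0 from the right as well.\<close>

lemma differentiable_at_zero_imp_small:
  fixes L :: "real \<Rightarrow> real"
  assumes L: "L differentiable (at 0)" and neg: "\<And>x. x < 0 \<Longrightarrow> L x = 0" and \<eta>: "0 < \<eta>"
  shows "\<exists>\<delta>>0. \<forall>x. 0 \<le> x \<and> x \<le> \<delta> \<longrightarrow> \<bar>L x\<bar> \<le> \<eta> * x"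
proof -
  obtain D where D: "(L has_field_derivative D) (at 0)"
    using L by (auto simp: real_differentiable_def)
  have "(L \<longlongrightarrow> L 0) (at_left 0)"
    using DERIV_isCont[OF D] by (auto simp: isCont_def intro: tendsto_mono[OF at_le])
  moreover have zero: "((\<lambda>_. 0) \<longlongrightarrow> L 0) (at_left (0::real))" if "(L \<longlongrightarrow> L 0) (at_left 0)"
    by (rule Lim_transform_eventually[OF that]) (auto simp: eventually_at_filter neg)
  ultimately have L0: "L 0 = 0"
    using tendsto_unique[OF trivial_limit_at_left_real zero tendsto_const] by simp
  have lim: "((\<lambda>x. L x / x) \<longlongrightarrow> D) (at 0)"
    using D by (simp add: has_field_derivative_iff L0)
  have "((\<lambda>_. 0) \<longlongrightarrow> D) (at_left (0::real))"
    by (rule Lim_transform_eventually[OF tendsto_mono[OF at_le lim]])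
       (auto simp: eventually_at_filter neg)
  then have "D = 0"
    using tendsto_unique[OF trivial_limit_at_left_real _ tendsto_const] by blast
  then have "\<forall>\<^sub>F x in at 0. dist (L x / x) 0 < \<eta>"
    using tendstoD[OF lim \<eta>] by simp
  then obtain d where d: "d > 0" "\<And>x. x \<noteq> 0 \<Longrightarrow> \<bar>x\<bar> < d \<Longrightarrow> \<bar>L x / x\<bar> < \<eta>"
    unfolding eventually_at by (auto simp: dist_real_def)
  have "\<bar>L x\<bar> \<le> \<eta> * x" if "0 \<le> x" "x \<le> d / 2" for x
    using d(2)[of x] that d(1) by (cases "x = 0") (auto simp: L0 field_simps)
  then show ?thesis
    using d(1) by (intro exI[of _ "d / 2"]) auto
qed

section \<open>Tame intervals: deterministic consequences and probability\<close>

text \<open>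
  The ratio \<open>9/10\<close> lies strictly between \<open>2 powr (-1/4)\<close> and \<open>1\<close>, so that both the union bound over
  dyadic levels with fourth moments and the chaining sum converge; the factor \<open>6\<close> makes the union
  bound less than \<open>1/2\<close>.
\<close>
definition tame_on :: "real \<Rightarrow> real \<Rightarrow> (real \<Rightarrow> real) \<Rightarrow> bool" where
  "tame_on a h g \<longleftrightarrow> (\<forall>j. \<forall>i<2 ^ j.
     \<bar>g (a + real (Suc i) * h / 2 ^ j) - g (a + real i * h / 2 ^ j)\<bar> \<le> 6 * sqrt h * (9 / 10) ^ j)"

text \<open>Chaining bounds the deviation from \<open>g a\<close> by
  \<open>6 * sqrt h / (1 - 9/10) = 60 * sqrt h\<close>, and the tree distance costs another factor
  4.\<close>

lemma tame_on_tree_distance: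
  assumes g: "tame_on a h g" and h: "0 < h" and cont: "continuous_on {a..a+h} g"
    and st: "a \<le> s" "s \<le> t" "t \<le> a + h"
  shows "tree_distance g s t \<le> 240 * sqrt h"
proof -
  have "\<bar>g x - g a\<bar> \<le> 60 * sqrt h" if "x \<in> {a..a+h}" for x
  proof -
    have "\<bar>g x - g a\<bar> \<le> 6 * sqrt h / (1 - 9 / 10)"
      using g h cont that unfolding tame_on_def by (intro dyadic_chaining) auto
    then show ?thesis
      by simp
  qed
  then have "tree_distance g s t \<le> 4 * (60 * sqrt h)"
    using st by (intro tree_distance_le[of a "a + h"]) auto
  then show ?thesis
    by simp
qed

text \<open>Let \<open>S\<close> index the tame intervals and put
  \<open>\<epsilon> = 240 * sqrt h\<close>. The close pairs have area at least
  \<open>card S * h^2 / 4\<close> and at most \<open>\<eta> * \<epsilon>^2 / 2\<close>, which is a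
  multiple of \<open>\<eta> * h\<close>. So \<open>card S * h\<close>, which is half the tame
  fraction, is bounded by a multiple of the arbitrarily small \<open>\<eta>\<close>.\<close>

lemma tame_fraction_tendsto_0:
  assumes L: "distance_profile g L" and g: "continuous_on {0..1} g" and diff: "L differentiable (at 0)"
  shows "(\<lambda>n. card {k. k < Suc n \<and> tame_on (1/4 + real k * (1 / (2 * Suc n))) (1 / (2 * Suc n)) g} / Suc n) \<longlonglongrightarrow> 0"
    (is "?F \<longlonglongrightarrow> 0")
proof (rule LIMSEQ_I)
  fix r :: real assume r: "0 < r"
  \<comment> \<open>The final estimate bounds the fraction by \<open>230400 * \<eta>\<close>, where
    \<open>230400 = 4 * 240^2\<close>; any larger divisor of \<open>r\<close> works.\<close>
  define \<eta> where "\<eta> = r / 300000"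
  have \<eta>: "0 < \<eta>"
    using r by (simp add: \<eta>_def)
  have "\<And>x. x < 0 \<Longrightarrow> L x = 0"
    using L by (simp add: distance_profile_def)
  from differentiable_at_zero_imp_small[OF diff this \<eta>]
  obtain \<delta> where \<delta>: "\<delta> > 0" "\<And>x. 0 \<le> x \<Longrightarrow> x \<le> \<delta> \<Longrightarrow> \<bar>L x\<bar> \<le> \<eta> * x"
    by blast
  \<comment> \<open>The threshold \<open>\<epsilon>\<close> tends to 0 and so eventually enters the
    range in which \<open>L\<close> is small.\<close>
  have "(\<lambda>n. 240 * sqrt (1 / 2 * inverse (real (Suc n)))) \<longlonglongrightarrow> 240 * sqrt (1 / 2 * 0)"
    by (intro tendsto_intros LIMSEQ_inverse_real_of_nat)
  then have "\<forall>\<^sub>F n in sequentially. 240 * sqrt (1 / 2 * inverse (real (Suc n))) < \<delta>"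
    using \<delta>(1) by (intro order_tendstoD) auto
  then obtain N where N: "\<And>n. n \<ge> N \<Longrightarrow> 240 * sqrt (1 / 2 * inverse (real (Suc n))) < \<delta>"
    by (auto simp: eventually_sequentially)
  have "norm (?F n - 0) < r" if n: "n \<ge> N" for n
  proof -
    define h where "h = 1 / (2 * real (Suc n))"
    define \<epsilon> where "\<epsilon> = 240 * sqrt h"
    define S where "S = {k. k < Suc n \<and> tame_on (1/4 + real k * h) h g}"
    have h: "0 < h" "real (Suc n) * h = 1/2"
      by (simp_all add: h_def)
    have "1 / 2 * inverse (real (Suc n)) = h"
      by (simp add: h_def field_simps)
    then have \<epsilon>: "0 < \<epsilon>" "\<epsilon> < \<delta>"
      using N[OF n] h by (simp_all add: \<epsilon>_def)
    have "real (card S) * h\<^sup>2 / 4 \<le> measure (lborel \<Otimes>\<^sub>M lborel) (close_pairs g \<epsilon>)"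
    proof (rule measure_close_pairs_ge[OF g])
      fix k s t assume k: "k \<in> S" and st: "1/4 + real k * h \<le> s" "s \<le> t" "t \<le> 1/4 + real k * h + h"
      have "0 \<le> real k * h" "(real k + 1) * h \<le> real (Suc n) * h"
        using k h(1) by (auto simp: S_def intro!: mult_right_mono)
      then have "{1/4 + real k * h..1/4 + real k * h + h} \<subseteq> {0..1}"
        using h(2) by (auto simp: algebra_simps)
      then show "tree_distance g s t \<le> \<epsilon>"
        unfolding \<epsilon>_def using k st h(1)
        by (intro tame_on_tree_distance continuous_on_subset[OF g]) (auto simp: S_def)
    qed (use h in \<open>auto simp: S_def\<close>)
    moreover have "2 * measure (lborel \<Otimes>\<^sub>M lborel) (close_pairs g \<epsilon>) \<le> (\<eta> * \<epsilon>) * \<epsilon>"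
    proof (rule measure_close_pairs_le[OF L])
      fix x assume x: "0 \<le> x" "x \<le> \<epsilon>"
      then have "\<bar>L x\<bar> \<le> \<eta> * x"
        using \<epsilon> by (intro \<delta>(2)) auto
      also have "\<dots> \<le> \<eta> * \<epsilon>"
        using x \<eta> by (intro mult_left_mono) auto
      finally show "\<bar>L x\<bar> \<le> \<eta> * \<epsilon>" .
    qed (use \<epsilon> in auto)
    moreover have "(\<eta> * \<epsilon>) * \<epsilon> = 57600 * \<eta> * h"
      using h(1) by (simp add: \<epsilon>_def)
    ultimately have "(real (card S) * h) * h \<le> (115200 * \<eta>) * h"
      by (simp add: power2_eq_square)
    then have "real (card S) * h \<le> 115200 * \<eta>"
      using h(1) by simp
    then have "2 * (real (card S) * h) \<le> 230400 * \<eta>"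
      by linarith
    also have "2 * (real (card S) * h) = real (card S) / Suc n"
      unfolding h_def by (simp add: field_simps)
    finally have "real (card S) / Suc n \<le> 230400 * \<eta>" .
    also have "230400 * \<eta> < r"
      using r by (simp add: \<eta>_def)
    finally have "real (card S) / Suc n < r" .
    then show ?thesis
      by (simp add: S_def h_def)
  qed
  then show "\<exists>N. \<forall>n\<ge>N. norm (?F n - 0) < r"
    by blast
qed

text \<open>Tameness is a countable conjunction of conditions at grid points, all of which lie
  strictly between 0 and 1.\<close>

lemma tame_on_measurable:
  assumes e: "brownian_excursion M e" and a: "0 < a" "a + h < 1" and h: "0 < h"
  shows "{\<omega>\<in>space M. tame_on a h (e \<omega>)} \<in> sets M"
proof -
  have m: "(\<lambda>\<omega>. e \<omega> (a + real i * h / 2 ^ j)) \<in> borel_measurable M" if "i \<le> 2 ^ j" for i j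
  proof (rule excursion_measurable[OF e])
    have "real i \<le> real (2 ^ j)"
      using that by (simp only: of_nat_le_iff)
    then have "real i * h / 2 ^ j \<le> h"
      using h by (simp add: field_simps)
    then show "a + real i * h / 2 ^ j < 1"
      using a by simp
    show "0 < a + real i * h / 2 ^ j"
      using a h by (simp add: add_pos_nonneg)
  qed
  have "{\<omega>\<in>space M. tame_on a h (e \<omega>)} = {\<omega>\<in>space M. \<forall>j. \<forall>i\<in>{..<2 ^ j}.
     \<bar>e \<omega> (a + real (Suc i) * h / 2 ^ j) - e \<omega> (a + real i * h / 2 ^ j)\<bar> \<le> 6 * sqrt h * (9 / 10) ^ j}"
    by (auto simp: tame_on_def)
  also have "\<dots> \<in> sets M"
    by (intro sets.sets_Collect_countable_All sets.sets_Collect_finite_All' borel_measurable_le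
          borel_measurable_abs borel_measurable_diff borel_measurable_const m) (auto simp: lessThan_empty_iff)
  finally show ?thesis .
qed

text \<open>A union bound over all levels. Level \<open>j\<close> has \<open>2^j\<close> increments,
  each failing with probability at most \<open>2/27 * (q / 2)^j\<close>, so the level fails with
  probability at most \<open>2/27 * q^j\<close>. As \<open>q \<le> 4/5\<close>, the sum over
  \<open>j\<close> is at most \<open>10/27 < 1/2\<close>.\<close>

lemma prob_tame_on_ge:
  assumes M: "prob_space M" and e: "brownian_excursion M e"
    and a: "1/4 \<le> a" "a + h \<le> 3/4" and h: "0 < h"
  shows "1 / 2 \<le> measure M {\<omega>\<in>space M. tame_on a h (e \<omega>)}"
proof -
  interpret prob_space M by fact
  \<comment> \<open>Raising \<open>j\<close> by one divides the squared mesh by 4 and the fourth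
    power of the threshold by \<open>(10/9)^4\<close>, but doubles the number of increments;
    \<open>q\<close> is the net ratio.\<close>
  define q :: real where "q = 1 / (2 * (9 / 10) ^ 4)"
  have q: "0 < q" "q \<le> 4 / 5"
    by (simp_all add: q_def power_divide)
  define B where "B j i = {\<omega>\<in>space M. 6 * sqrt h * (9 / 10) ^ j <
     \<bar>e \<omega> (a + real (Suc i) * h / 2 ^ j) - e \<omega> (a + real i * h / 2 ^ j)\<bar>}" for i j :: nat
  define U where "U j = (\<Union>i<2 ^ j. B j i)" for j
  have range: "a + real i * h / 2 ^ j \<le> 3/4" "1/4 \<le> a + real i * h / 2 ^ j" if "i \<le> 2 ^ j" for i j
  proof -
    have "real i \<le> real (2 ^ j)"
      using that by (simp only: of_nat_le_iff)
    then have "real i * h / 2 ^ j \<le> h" "0 \<le> real i * h / 2 ^ j"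
      using h by (simp_all add: field_simps)
    then show "a + real i * h / 2 ^ j \<le> 3/4" "1/4 \<le> a + real i * h / 2 ^ j"
      using a by linarith+
  qed
  have sB: "B j i \<in> sets M" if "i < 2 ^ j" for i j
  proof -
    have "(\<lambda>\<omega>. e \<omega> (a + real l * h / 2 ^ j)) \<in> borel_measurable M" if "l \<le> 2 ^ j" for l
      using range[OF that] by (intro excursion_measurable[OF e]) linarith+
    from this[of i] this[of "Suc i"]
    have [measurable]: "(\<lambda>\<omega>. e \<omega> (a + real i * h / 2 ^ j)) \<in> borel_measurable M"
      "(\<lambda>\<omega>. e \<omega> (a + real (Suc i) * h / 2 ^ j)) \<in> borel_measurable M"
      using that by simp_all
    show ?thesis
      unfolding B_def by measurable
  qed
  have mB: "measure M (B j i) \<le> 2 / 27 * (q / 2) ^ j" if i: "i < 2 ^ j" for i j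
  proof -
    have d: "a + real (Suc i) * h / 2 ^ j - (a + real i * h / 2 ^ j) = h / 2 ^ j"
      by (simp add: field_simps)
    have "0 < h / 2 ^ j"
      using h by simp
    then have less: "a + real i * h / 2 ^ j < a + real (Suc i) * h / 2 ^ j"
      using d by linarith
    have "measure M (B j i) \<le> 96 * (a + real (Suc i) * h / 2 ^ j - (a + real i * h / 2 ^ j))\<^sup>2
        / (6 * sqrt h * (9 / 10) ^ j) ^ 4"
      unfolding B_def using range(2)[of i j] range(1)[of "Suc i" j] i h
      by (intro excursion_increment_tail[OF M e] less) auto
    also have "\<dots> = 96 * (h / 2 ^ j)\<^sup>2 / (6 * sqrt h * (9 / 10) ^ j) ^ 4"
      by (simp only: d)
    also have "(6 * sqrt h * (9 / 10) ^ j) ^ 4 = 1296 * (sqrt h ^ 4) * ((9 / 10) ^ 4) ^ j"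
      by (simp only: power_mult_distrib power_mult[symmetric] mult.commute[of j]) simp
    also have "sqrt h ^ 4 = h\<^sup>2"
      using h power_mult[of "sqrt h" 2 2] by simp
    \<comment> \<open>Since the threshold scales like \<open>sqrt h\<close>, the length
      \<open>h\<close> cancels and the bound is uniform over intervals; \<open>2/27\<close> is
      \<open>96 / 6^4\<close>.\<close>
    also have "96 * (h / 2 ^ j)\<^sup>2 / (1296 * h\<^sup>2 * ((9 / 10) ^ 4) ^ j) = 2 / 27 * (q / 2) ^ j"
    proof -
      have "(h / 2 ^ j)\<^sup>2 = h\<^sup>2 * (1 / 4) ^ j"
        by (simp add: power_divide power2_eq_square flip: power_mult_distrib)
      moreover have "(q / 2) ^ j = (1 / 4) ^ j / ((9 / 10) ^ 4) ^ j"
        unfolding power_divide[symmetric] by (simp add: q_def)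
      ultimately show ?thesis
        using h by simp
    qed
    finally show ?thesis .
  qed
  have mU: "measure M (U j) \<le> 2 / 27 * q ^ j" for j
  proof -
    have "measure M (U j) \<le> (\<Sum>i<2 ^ j. measure M (B j i))"
      unfolding U_def by (intro measure_UNION_le sB) auto
    also have "\<dots> \<le> (\<Sum>i<(2::nat) ^ j. 2 / 27 * (q / 2) ^ j)"
      by (intro sum_mono mB) auto
    also have "\<dots> = 2 / 27 * q ^ j"
      by (simp add: power_divide)
    finally show ?thesis .
  qed
  have summ: "summable (\<lambda>j. 2 / 27 * q ^ j)"
    using q by (intro summable_mult summable_geometric) auto
  have summU: "summable (\<lambda>j. measure M (U j))"
    using mU by (intro summable_comparison_test'[OF summ]) auto
  have sU: "range U \<subseteq> sets M"
    using sB by (auto simp: U_def)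
  have "measure M (\<Union>j. U j) \<le> (\<Sum>j. measure M (U j))"
    by (rule finite_measure_subadditive_countably[OF sU summU])
  also have "\<dots> \<le> (\<Sum>j. 2 / 27 * q ^ j)"
    by (intro suminf_le mU summU summ)
  also have "\<dots> = 2 / 27 * (1 / (1 - q))"
    using q by (subst suminf_mult) (simp_all add: suminf_geometric)
  also have "\<dots> \<le> 1 / 2"
    using q by (simp add: field_simps)
  finally have "measure M (\<Union>j. U j) \<le> 1 / 2" .
  moreover have "{\<omega>\<in>space M. tame_on a h (e \<omega>)} = space M - (\<Union>j. U j)"
  proof (rule set_eqI)
    fix \<omega>
    have "\<omega> \<in> (\<Union>j. U j) \<longleftrightarrow> \<omega> \<in> space M \<and> \<not> tame_on a h (e \<omega>)"
      by (simp add: tame_on_def U_def B_def Bex_def not_le)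
    then show "\<omega> \<in> {\<omega>\<in>space M. tame_on a h (e \<omega>)} \<longleftrightarrow> \<omega> \<in> space M - (\<Union>j. U j)"
      by auto
  qed
  moreover have "(\<Union>j. U j) \<in> sets M"
    using sU by blast
  ultimately show ?thesis
    by (simp add: prob_compl)
qed

section \<open>Conclusion by dominated convergence\<close>

theorem theorem15p10:
  fixes M :: "'w measure" and e \<Lambda> :: "'w \<Rightarrow> real \<Rightarrow> real"
  assumes "prob_space M"
    and "brownian_excursion M e"
    and "random_distance_profile M e \<Lambda>"
  shows "\<not> (AE \<omega> in M. \<Lambda> \<omega> differentiable (at 0))"
proof
  assume diff: "AE \<omega> in M. \<Lambda> \<omega> differentiable (at 0)"
  interpret prob_space M by fact
  \<comment> \<open>The \<open>Suc n\<close> intervals of length \<open>h n\<close> tile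
    \<open>[1/4, 3/4]\<close>; the successor avoids a division by 0. \<open>F n\<close> is the
    fraction of them that are tame.\<close>
  define h where "h n = 1 / (2 * real (Suc n))" for n
  define G where "G n k = {\<omega>\<in>space M. tame_on (1/4 + real k * h n) (h n) (e \<omega>)}" for n k
  define F where "F n \<omega> = (\<Sum>k<Suc n. indicat_real (G n k) \<omega>) / Suc n" for n \<omega>
  have h: "0 < h n" "real (Suc n) * h n = 1/2" for n
    by (simp_all add: h_def)
  have range: "1/4 \<le> 1/4 + real k * h n" "1/4 + real k * h n + h n \<le> 3/4" if "k < Suc n" for n k
  proof -
    have "0 \<le> real k * h n" "(real k + 1) * h n \<le> real (Suc n) * h n"
      using that h(1)[of n] by (auto intro!: mult_right_mono)
    then show "1/4 \<le> 1/4 + real k * h n" "1/4 + real k * h n + h n \<le> 3/4"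
      using h(2)[of n] by (auto simp: algebra_simps)
  qed
  have sG: "G n k \<in> sets M" if "k < Suc n" for n k
    unfolding G_def using range[OF that] h(1) by (intro tame_on_measurable[OF assms(2)]) auto
  have F_eq: "F n \<omega> = card {k. k < Suc n \<and> tame_on (1/4 + real k * h n) (h n) (e \<omega>)} / Suc n"
    if "\<omega> \<in> space M" for n \<omega>
  proof -
    have "(\<Sum>k<Suc n. indicat_real (G n k) \<omega>) =
        (\<Sum>k<Suc n. if tame_on (1/4 + real k * h n) (h n) (e \<omega>) then 1 else 0)"
      using that by (intro sum.cong) (auto simp: G_def indicator_def)
    also have "\<dots> = card {k. k < Suc n \<and> tame_on (1/4 + real k * h n) (h n) (e \<omega>)}"
      by (subst sum.inter_filter[symmetric]) auto
    finally show ?thesis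
      by (simp add: F_def)
  qed
  have mF: "F n \<in> borel_measurable M" for n
    unfolding F_def using sG
    by (intro borel_measurable_divide borel_measurable_sum borel_measurable_indicator borel_measurable_const) auto
  have lim: "AE \<omega> in M. (\<lambda>n. F n \<omega>) \<longlonglongrightarrow> 0"
  proof -
    have "AE \<omega> in M. distance_profile (e \<omega>) (\<Lambda> \<omega>)"
      using assms(3) by (simp add: random_distance_profile_def)
    with diff show ?thesis
      using AE_space
    proof eventually_elim
      case (elim \<omega>)
      have "continuous_on {0..1} (e \<omega>)"
        using assms(2) elim(3) by (simp add: brownian_excursion_def)
      from tame_fraction_tendsto_0[OF elim(2) this elim(1)] show ?case
        using elim(3) by (simp add: F_eq h_def)
    qed
  qed
  have bound: "norm (F n \<omega>) \<le> 1" for n \<omega>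
  proof -
    have "(\<Sum>k<Suc n. indicat_real (G n k) \<omega>) \<le> (\<Sum>k<Suc n. 1)"
      by (intro sum_mono) (auto simp: indicator_def)
    then show ?thesis
      by (simp add: F_def sum_nonneg del: sum.lessThan_Suc)
  qed
  \<comment> \<open>The fractions lie between 0 and 1 and tend to 0 almost surely, so their means
    tend to 0.\<close>
  have "(\<lambda>n. integral\<^sup>L M (F n)) \<longlonglongrightarrow> integral\<^sup>L M (\<lambda>_. 0)"
    by (rule integral_dominated_convergence[where w = "\<lambda>_. 1"]) (use mF lim bound in auto)
  \<comment> \<open>By linearity, the mean of \<open>F n\<close> is the average of the probabilities
    of tameness, each at least \<open>1/2\<close>, whatever the dependence between the
    intervals.\<close>
  moreover have "1 / 2 \<le> integral\<^sup>L M (F n)" for n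
  proof -
    have "1 / 2 = (\<Sum>k<Suc n. 1 / 2) / real (Suc n)"
      by (simp del: sum.lessThan_Suc)
    also have "\<dots> \<le> (\<Sum>k<Suc n. measure M (G n k)) / Suc n"
      unfolding G_def using range h(1)
      by (intro divide_right_mono sum_mono prob_tame_on_ge[OF assms(1,2)]) auto
    also have "(\<Sum>k<Suc n. measure M (G n k)) = (\<Sum>k<Suc n. integral\<^sup>L M (indicat_real (G n k)))"
      using sets.sets_into_space[OF sG] by (intro sum.cong refl) (auto simp: Int_absorb2)
    also have "\<dots> = integral\<^sup>L M (\<lambda>\<omega>. \<Sum>k<Suc n. indicat_real (G n k) \<omega>)"
      using sG by (intro Bochner_Integration.integral_sum[symmetric]) (auto simp: emeasure_eq_measure)
    also have "\<dots> / Suc n = integral\<^sup>L M (F n)"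
      unfolding F_def by (simp del: sum.lessThan_Suc)
    finally show ?thesis .
  qed
  ultimately show False
    using LIMSEQ_le_const[of "\<lambda>n. integral\<^sup>L M (F n)" 0 "1/2"] by auto
qed

end
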